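(* Let $n,m,r\ge 1$ be integers, let $A_1,\dots,A_m\in\mathbb{S}^n$ and $b=[b_1\ \ldots\ b_m]^{T}\in\mathbb{R}^m$. For $i=1,\dots,m$ let $\widehat A_i=\bigoplus_{j=1}^{r}A_i\in\mathbb{S}^{rn}$ be the block diagonal matrix with $r$ diagonal blocks all equal to $A_i$. Consider the system $$\operatorname{Tr}(A_iX)=b_i,\quad i=1,\dots,m,\qquad (\mathrm{I})$$ in the unknown positive semidefinite matrix $X\in\mathbb{S}^n_+$, and the system of quadratic equations $$\hat x^{T}\widehat A_i\hat x=b_i,\quad i=1,\dots,m,\qquad (\mathrm{II})$$ in the unknown $\hat x=[x_1^{T}\ \ldots\ x_r^{T}]^{T}\in\mathbb{R}^{rn}$ with $x_1,\dots,x_r\in\mathbb{R}^n$. If (I) has a solution $X\in\mathbb{S}^n_+$ of rank $r$, then (II) has a nonzero solution. Conversely, if (II) has a nonzero solution, then (I) has a solution $X\in\mathbb{S}^n_+$ of rank less than or equal to $r$.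
   Context: $\mathbb{S}^n$ denotes the set of $n\times n$ real symmetric matrices, $\mathbb{S}^n_+$ the cone of positive semidefinite matrices in $\mathbb{S}^n$, and $\operatorname{Tr}$ the trace. *)

theory Defs
  imports "Jordan_Normal_Form.DL_Rank"
begin

definition mat_trace :: "'a :: comm_monoid_add mat \<Rightarrow> 'a" where
  "mat_trace A = (\<Sum>i<dim_row A. A $$ (i, i))"

definition sym_mats :: "nat \<Rightarrow> real mat set" where
  "sym_mats n = {A \<in> carrier_mat n n. transpose_mat A = A}"

definition psd_mats :: "nat \<Rightarrow> real mat set" where
  "psd_mats n = {X \<in> sym_mats n. \<forall>v \<in> carrier_vec n. 0 \<le> v \<bullet> (X *\<^sub>v v)}"

(* vec_space.rank n X is the dimension of the column span of X inside the space of
   vectors of length n, so the argument n must be the number of rows of X. *)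
abbreviation mat_rank :: "real mat \<Rightarrow> nat" where
  "mat_rank X \<equiv> vec_space.rank (dim_row X) X"

end

theory Submission
  imports Defs
begin

text \<open>
  Write \<open>x\<^sub>1, \<dots>, x\<^sub>r\<close> for the blocks of length \<open>n\<close> of a vector \<open>x\<close> of length \<open>r * n\<close>, and set
  \<open>X = x\<^sub>1 x\<^sub>1\<^sup>T + \<dots> + x\<^sub>r x\<^sub>r\<^sup>T\<close>.  The quadratic form of the block diagonal matrix with \<open>r\<close> copies
  of \<open>A\<close>, taken at \<open>x\<close>, is the sum of the numbers \<open>x\<^sub>k\<^sup>T A x\<^sub>k = Tr (A x\<^sub>k x\<^sub>k\<^sup>T)\<close>, hence it equals
  \<open>Tr (A X)\<close> (\<open>trace_mult_sum_outer_vec_block\<close>).  So the two systems are the same once it is known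
  which matrices \<open>X\<close> arise from some \<open>x\<close>.

  Every \<open>X\<close> of this form is positive semidefinite, and its rank is at most \<open>r\<close>, because
  \<open>X = M M\<^sup>T\<close> for the matrix \<open>M\<close> with the \<open>r\<close> columns \<open>x\<^sub>k\<close> (\<open>sum_outer_psd\<close>,
  \<open>rank_sum_outer_le\<close>).  Conversely every positive semidefinite \<open>X\<close> of rank at most \<open>r\<close> has this
  form (\<open>psd_eq_sum_outer\<close>).  Instead of diagonalizing, the proof peels off one outer product at a
  time: if \<open>v\<^sup>T X v > 0\<close>, then \<open>X - (X v) (X v)\<^sup>T / (v\<^sup>T X v)\<close> is again positive semidefinite, by the
  Cauchy-Schwarz inequality of the form \<open>X\<close>, and it has strictly smaller rank, since its column
  space lies in that of \<open>X\<close> and is orthogonal to \<open>v\<close>, whereas \<open>X v\<close> is not (\<open>psd_deflation\<close>).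
  If no such \<open>v\<close> exists, then \<open>X = 0\<close> by polarization, and zero vectors serve as the
  remaining \<open>x\<^sub>k\<close>.  Finally, a matrix \<open>X\<close> of rank \<open>r \<ge> 1\<close> is nonzero and therefore cannot come
  from \<open>x = 0\<close>.
\<close>

section \<open>Comparing ranks through column spaces\<close>

text \<open>
  Unlike for \<open>rank_ge_card_indpt\<close>, the independent vectors may be any elements of the column
  space; this is what allows matrices with different columns to be compared.
\<close>

lemma (in vec_space) card_lin_indpt_le_rank:
  assumes A: "A \<in> carrier_mat n nc" and U: "U \<subseteq> col_space A" and li: "lin_indpt U"
  shows "finite U" "card U \<le> rank A"
proof -
  let ?W = "span (set (cols A))"
  have cA: "set (cols A) \<subseteq> carrier_vec n" using A cols_dim by blast
  have UW: "U \<subseteq> ?W" using U unfolding col_space_def .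
  have sub: "submodule class_ring ?W V" using cA by (simp add: span_is_submodule)
  have vs: "vectorspace class_ring (vs ?W)"
    using span_is_subspace[THEN subspace_is_vs] cA by auto
  have fd: "vectorspace.fin_dim class_ring (vs ?W)" using fin_dim_span_cols[OF A] .
  have c: "U \<subseteq> carrier (vs ?W)" using UW by simp
  have li': "\<not> LinearCombinations.module.lin_dep class_ring (vs ?W) U"
    using span_li_not_depend(2)[OF UW sub] li by simp
  show "finite U" by (rule vectorspace.li_le_dim(1)[OF vs fd c li'])
  show "card U \<le> rank A" unfolding rank_def by (rule vectorspace.li_le_dim(2)[OF vs fd c li'])
qed

lemma (in vec_space) obtain_col_basis:
  assumes A: "A \<in> carrier_mat n nc"
  obtains S where "finite S" "S \<subseteq> carrier_vec n" "lin_indpt S" "span S = col_space A" "card S = rank A"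
proof -
  have cA: "set (cols A) \<subseteq> carrier_vec n" using A cols_dim by blast
  obtain S where max: "maximal S (\<lambda>T. T \<subseteq> set (cols A) \<and> lin_indpt T)"
    using maximal_exists[of "(\<lambda>T. T \<subseteq> set (cols A) \<and> lin_indpt T)" "card (set (cols A))" "{}"]
    by (meson List.finite_set card_mono empty_iff empty_subsetI finite_lin_indpt2 rev_finite_subset)
  then have S: "S \<subseteq> set (cols A)" "lin_indpt S" unfolding maximal_def by auto
  then have Sc: "S \<subseteq> carrier_vec n" and fS: "finite S" using cA finite_subset by auto
  have "set (cols A) \<subseteq> span S"
  proof
    fix a assume a: "a \<in> set (cols A)"
    \<comment> \<open>Otherwise \<open>a\<close> could be added to the maximal independent set \<open>S\<close>.\<close>
    show "a \<in> span S"
    proof (rule ccontr)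
      assume no: "a \<notin> span S"
      have aS: "a \<notin> S" using no Sc span_mem by auto
      have "lin_indpt (S \<union> {a})"
        using lin_dep_iff_in_span[OF Sc S(2) _ aS] no a cA by auto
      then have "S \<union> {a} = S" using max a S(1) unfolding maximal_def by blast
      with aS show False by auto
    qed
  qed
  then have "span (set (cols A)) \<subseteq> span S"
    using span_is_subset[OF _ span_is_submodule] Sc by auto
  moreover have "span S \<subseteq> span (set (cols A))" using S(1) by (rule span_is_monotone)
  ultimately have "span S = col_space A" unfolding col_space_def by auto
  then show ?thesis using that fS Sc S(2) rank_card_indpt[OF A max] by auto
qed

lemma (in vec_space) rank_mono_col_space:
  assumes A: "A \<in> carrier_mat n nc" and B: "B \<in> carrier_mat n nc'"
    and le: "col_space A \<subseteq> col_space B"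
  shows "rank A \<le> rank B"
proof -
  obtain S where S: "S \<subseteq> carrier_vec n" "lin_indpt S" "span S = col_space A" "card S = rank A"
    using obtain_col_basis[OF A] by metis
  have "S \<subseteq> col_space B" using in_own_span[of S] S le by auto
  then show ?thesis using card_lin_indpt_le_rank(2)[OF B _ S(2)] S(4) by auto
qed

text \<open>
  A basis of the smaller column space stays independent when a vector \<open>u\<close> outside of that space
  is added to it.
\<close>

lemma (in vec_space) rank_less_col_space:
  assumes A: "A \<in> carrier_mat n nc" and B: "B \<in> carrier_mat n nc'"
    and less: "col_space A \<subset> col_space B"
  shows "rank A < rank B"
proof -
  obtain S where S: "finite S" "S \<subseteq> carrier_vec n" "lin_indpt S" "span S = col_space A"
      "card S = rank A"
    using obtain_col_basis[OF A] by metis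
  obtain u where u: "u \<in> col_space B" "u \<notin> span S" using less S(4) by auto
  have uc: "u \<in> carrier_vec n" using u(1) B col_space_eq[OF B] by auto
  have SA: "S \<subseteq> span S" using in_own_span[of S] S(2) by auto
  then have uS: "u \<notin> S" using u(2) by auto
  have "lin_indpt (S \<union> {u})" using lin_dep_iff_in_span[OF S(2,3) _ uS] uc u(2) by auto
  moreover have "S \<union> {u} \<subseteq> col_space B" using SA S(4) less u(1) by auto
  ultimately have "card (S \<union> {u}) \<le> rank B" using card_lin_indpt_le_rank(2)[OF B] by blast
  then show ?thesis using S(1,5) uS by simp
qed

section \<open>Sums of outer products\<close>

definition sum_outer :: "nat \<Rightarrow> nat \<Rightarrow> (nat \<Rightarrow> real vec) \<Rightarrow> real mat" where
  "sum_outer n r x = mat n n (\<lambda>(i, j). \<Sum>k<r. x k $ i * x k $ j)"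

lemma sum_outer_carrier [simp]: "sum_outer n r x \<in> carrier_mat n n"
  and dim_sum_outer [simp]: "dim_row (sum_outer n r x) = n" "dim_col (sum_outer n r x) = n"
  and index_sum_outer [simp]:
    "i < n \<Longrightarrow> j < n \<Longrightarrow> sum_outer n r x $$ (i, j) = (\<Sum>k<r. x k $ i * x k $ j)"
  by (auto simp: sum_outer_def)

lemma sum_outer_zero: "sum_outer n r (\<lambda>_. 0\<^sub>v n) = 0\<^sub>m n n"
  by (auto intro!: eq_matI)

lemma index_sum_outer_mult_vec:
  assumes "u \<in> carrier_vec n" and "i < n"
  shows "(sum_outer n r x *\<^sub>v u) $ i = (\<Sum>k<r. x k $ i * (x k \<bullet> u))"
proof -
  have "(sum_outer n r x *\<^sub>v u) $ i = (\<Sum>j<n. \<Sum>k<r. x k $ i * x k $ j * u $ j)"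
    using assms by (auto simp: scalar_prod_def sum_distrib_right lessThan_atLeast0)
  also have "\<dots> = (\<Sum>k<r. \<Sum>j<n. x k $ i * x k $ j * u $ j)" by (rule sum.swap)
  finally show ?thesis
    using assms by (simp add: scalar_prod_def sum_distrib_left mult.assoc lessThan_atLeast0)
qed

lemma scalar_prod_sum_outer:
  assumes v: "v \<in> carrier_vec n" and u: "u \<in> carrier_vec n"
    and x: "\<And>k. k < r \<Longrightarrow> x k \<in> carrier_vec n"
  shows "v \<bullet> (sum_outer n r x *\<^sub>v u) = (\<Sum>k<r. (x k \<bullet> v) * (x k \<bullet> u))"
proof -
  have "v \<bullet> (sum_outer n r x *\<^sub>v u) = (\<Sum>i<n. v $ i * (\<Sum>k<r. x k $ i * (x k \<bullet> u)))"
    using u by (auto simp: scalar_prod_def[of v] index_sum_outer_mult_vec lessThan_atLeast0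
        simp del: index_mult_mat_vec intro!: sum.cong)
  also have "\<dots> = (\<Sum>i<n. \<Sum>k<r. x k $ i * v $ i * (x k \<bullet> u))"
    by (simp add: sum_distrib_left mult_ac)
  also have "\<dots> = (\<Sum>k<r. \<Sum>i<n. x k $ i * v $ i * (x k \<bullet> u))" by (rule sum.swap)
  also have "\<dots> = (\<Sum>k<r. (x k \<bullet> v) * (x k \<bullet> u))"
    using v by (simp add: scalar_prod_def[of _ v] sum_distrib_right lessThan_atLeast0)
  finally show ?thesis .
qed

lemma sum_outer_psd:
  assumes "\<And>k. k < r \<Longrightarrow> x k \<in> carrier_vec n"
  shows "sum_outer n r x \<in> psd_mats n"
  using assms by (auto simp: psd_mats_def sym_mats_def scalar_prod_sum_outer mult.commute
      intro!: sum_nonneg eq_matI)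

lemma rank_sum_outer_le:
  assumes x: "\<And>k. k < r \<Longrightarrow> x k \<in> carrier_vec n"
  shows "vec_space.rank n (sum_outer n r x) \<le> r"
proof -
  interpret vec_space "TYPE(real)" n .
  \<comment> \<open>The matrix with columns \<open>x k\<close>: a product \<open>M * N\<close> has its column space inside that of \<open>M\<close>.\<close>
  define M where "M = mat n r (\<lambda>(i, k). x k $ i)"
  have M: "M \<in> carrier_mat n r" by (simp add: M_def)
  have eq: "sum_outer n r x = M * transpose_mat M"
    by (auto simp: M_def scalar_prod_def lessThan_atLeast0 intro!: eq_matI)
  have "col_space (sum_outer n r x) \<subseteq> col_space M"
  proof
    fix y assume "y \<in> col_space (sum_outer n r x)"
    then obtain u where u: "u \<in> carrier_vec n" "y = sum_outer n r x *\<^sub>v u"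
      unfolding col_space_eq[OF sum_outer_carrier] by auto
    have "y = M *\<^sub>v (transpose_mat M *\<^sub>v u)"
      unfolding u(2) eq using M u(1) by (intro assoc_mult_mat_vec) auto
    then show "y \<in> col_space M" unfolding col_space_eq[OF M] using M u(1)
      by (auto intro!: bexI[of _ "transpose_mat M *\<^sub>v u"])
  qed
  then have "rank (sum_outer n r x) \<le> rank M" by (rule rank_mono_col_space[OF sum_outer_carrier M])
  also have "\<dots> \<le> r" using M by (rule rank_le_nc)
  finally show ?thesis .
qed

lemma trace_mult_sum_outer:
  assumes A: "A \<in> carrier_mat n n" and x: "\<And>k. k < r \<Longrightarrow> x k \<in> carrier_vec n"
  shows "mat_trace (A * sum_outer n r x) = (\<Sum>k<r. x k \<bullet> (A *\<^sub>v x k))"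
proof -
  have "mat_trace (A * sum_outer n r x)
      = (\<Sum>i<n. \<Sum>j<n. \<Sum>k<r. A $$ (i, j) * (x k $ j * x k $ i))"
    using A by (auto simp: mat_trace_def scalar_prod_def lessThan_atLeast0 sum_distrib_left
        intro!: sum.cong)
  also have "\<dots> = (\<Sum>i<n. \<Sum>k<r. \<Sum>j<n. A $$ (i, j) * (x k $ j * x k $ i))"
    by (intro sum.cong refl sum.swap)
  also have "\<dots> = (\<Sum>k<r. \<Sum>i<n. \<Sum>j<n. A $$ (i, j) * (x k $ j * x k $ i))"
    by (rule sum.swap)
  also have "\<dots> = (\<Sum>k<r. x k \<bullet> (A *\<^sub>v x k))"
  proof (intro sum.cong refl)
    fix k assume "k \<in> {..<r}"
    then have "x k \<in> carrier_vec n" using x by auto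
    then show "(\<Sum>i<n. \<Sum>j<n. A $$ (i, j) * (x k $ j * x k $ i)) = x k \<bullet> (A *\<^sub>v x k)"
      using A by (auto simp: scalar_prod_def lessThan_atLeast0 sum_distrib_left mult_ac
          intro!: sum.cong)
  qed
  finally show ?thesis .
qed

section \<open>Factoring a positive semidefinite matrix by deflation\<close>

lemma sym_scalar_prod_commute:
  assumes X: "X \<in> sym_mats n" and u: "u \<in> carrier_vec n" and v: "v \<in> carrier_vec n"
  shows "u \<bullet> (X *\<^sub>v v) = v \<bullet> (X *\<^sub>v u)"
proof -
  have Xc: "X \<in> carrier_mat n n" and Xt: "transpose_mat X = X"
    using X by (auto simp: sym_mats_def)
  have "u \<bullet> (X *\<^sub>v v) = (transpose_mat X *\<^sub>v u) \<bullet> v"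
    using transpose_vec_mult_scalar[OF Xc v u] by simp
  also have "\<dots> = v \<bullet> (X *\<^sub>v u)"
    unfolding Xt using Xc u v by (intro comm_scalar_prod[of _ n]) auto
  finally show ?thesis .
qed

lemma quadratic_form_add_smult:
  assumes X: "X \<in> sym_mats n" and u: "u \<in> carrier_vec n" and v: "v \<in> carrier_vec n"
  shows "(u + t \<cdot>\<^sub>v v) \<bullet> (X *\<^sub>v (u + t \<cdot>\<^sub>v v))
    = u \<bullet> (X *\<^sub>v u) + 2 * t * (u \<bullet> (X *\<^sub>v v)) + t\<^sup>2 * (v \<bullet> (X *\<^sub>v v))"
proof -
  have Xc: "X \<in> carrier_mat n n" using X by (auto simp: sym_mats_def)
  have e: "X *\<^sub>v (u + t \<cdot>\<^sub>v v) = X *\<^sub>v u + t \<cdot>\<^sub>v (X *\<^sub>v v)"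
    using Xc u v by (simp add: mult_add_distrib_mat_vec[OF Xc u] mult_mat_vec[OF Xc v])
  have c: "X *\<^sub>v u \<in> carrier_vec n" "X *\<^sub>v v \<in> carrier_vec n" using Xc u v by auto
  show ?thesis
    unfolding e using u v c sym_scalar_prod_commute[OF X v u]
    by (simp add: add_scalar_prod_distrib[of _ n] scalar_prod_add_distrib[of _ n]
        power2_eq_square algebra_simps)
qed

text \<open>
  Polarization: the entry at \<open>(i, j)\<close> is the value of the bilinear form at two unit vectors, which
  the values of the quadratic form at those vectors and at their sum determine.
\<close>

lemma sym_quadratic_form_zero_imp_zero:
  assumes X: "X \<in> sym_mats n" and z: "\<And>v. v \<in> carrier_vec n \<Longrightarrow> v \<bullet> (X *\<^sub>v v) = 0"
  shows "X = 0\<^sub>m n n"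
proof (rule eq_matI)
  have Xc: "X \<in> carrier_mat n n" using X by (auto simp: sym_mats_def)
  fix i j assume "i < dim_row (0\<^sub>m n n :: real mat)" "j < dim_col (0\<^sub>m n n :: real mat)"
  then have i: "i < n" and j: "j < n" by auto
  have "unit_vec n i \<bullet> (X *\<^sub>v unit_vec n j) = 0"
    using quadratic_form_add_smult[OF X, of "unit_vec n i" "unit_vec n j" 1]
      z[of "unit_vec n i"] z[of "unit_vec n j"] z[of "unit_vec n i + 1 \<cdot>\<^sub>v unit_vec n j"] by simp
  then show "X $$ (i, j) = 0\<^sub>m n n $$ (i, j)"
    using Xc i j by (simp add: scalar_prod_left_unit scalar_prod_right_unit)
qed (use X in \<open>auto simp: sym_mats_def\<close>)

text \<open>
  The vector \<open>w\<close> is \<open>X v\<close>, scaled so that \<open>Y v = 0\<close>.  Then \<open>Y u = X p\<close>, where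
  \<open>p = u - (u\<^sup>T X v / v\<^sup>T X v) v\<close> is the part of \<open>u\<close> that is orthogonal to \<open>v\<close> for the form \<open>X\<close>.
  It follows that \<open>u\<^sup>T Y u = p\<^sup>T X p\<close> is nonnegative and that the column space of \<open>Y\<close> lies in that
  of \<open>X\<close>; the inclusion is strict, because \<open>X v\<close> is not orthogonal to \<open>v\<close>.
\<close>

lemma psd_deflation:
  assumes X: "X \<in> psd_mats n" and v: "v \<in> carrier_vec n" and q: "v \<bullet> (X *\<^sub>v v) > 0"
  obtains Y w where "Y \<in> psd_mats n" "w \<in> carrier_vec n" "X = Y + sum_outer n 1 (\<lambda>_. w)"
    "vec_space.rank n Y < vec_space.rank n X"
proof -
  interpret vec_space "TYPE(real)" n .
  define q where "q = v \<bullet> (X *\<^sub>v v)"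
  have q0: "q > 0" using q by (simp add: q_def)
  have Xs: "X \<in> sym_mats n" using X by (auto simp: psd_mats_def)
  then have Xc: "X \<in> carrier_mat n n" and Xt: "transpose_mat X = X" by (auto simp: sym_mats_def)
  define w where "w = (1 / sqrt q) \<cdot>\<^sub>v (X *\<^sub>v v)"
  have w: "w \<in> carrier_vec n" using Xc v by (auto simp: w_def)
  define Y where "Y = X - sum_outer n 1 (\<lambda>_. w)"
  have Yc: "Y \<in> carrier_mat n n" by (simp add: Y_def minus_carrier_mat)
  have XY: "X = Y + sum_outer n 1 (\<lambda>_. w)" using Xc by (auto simp: Y_def intro!: eq_matI)
  have Ys: "Y \<in> sym_mats n"
  proof -
    have "X $$ (j, i) = X $$ (i, j)" if "i < n" "j < n" for i j
      using that Xc arg_cong[OF Xt, of "\<lambda>M. M $$ (i, j)"] by simp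
    then show ?thesis using Yc Xc unfolding sym_mats_def
      by (auto simp: Y_def mult.commute intro!: eq_matI)
  qed
  have wu: "w \<bullet> u = (u \<bullet> (X *\<^sub>v v)) / sqrt q" if u: "u \<in> carrier_vec n" for u
    using Xc v u comm_scalar_prod[OF u, of "X *\<^sub>v v"] by (simp add: w_def)
  have Yu: "Y *\<^sub>v u = X *\<^sub>v (u + (- ((u \<bullet> (X *\<^sub>v v)) / q)) \<cdot>\<^sub>v v)" (is "_ = X *\<^sub>v ?p u")
    if u: "u \<in> carrier_vec n" for u
  proof -
    have "Y *\<^sub>v u = X *\<^sub>v u - sum_outer n 1 (\<lambda>_. w) *\<^sub>v u"
      unfolding Y_def using Xc u by (intro minus_mult_distrib_mat_vec) auto
    also have "\<dots> = X *\<^sub>v u + (- ((u \<bullet> (X *\<^sub>v v)) / q)) \<cdot>\<^sub>v (X *\<^sub>v v)"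
    proof (rule eq_vecI)
      fix i assume "i < dim_vec (X *\<^sub>v u + (- ((u \<bullet> (X *\<^sub>v v)) / q)) \<cdot>\<^sub>v (X *\<^sub>v v))"
      then have i: "i < n" using Xc by simp
      have "(sum_outer n 1 (\<lambda>_. w) *\<^sub>v u) $ i = w $ i * (w \<bullet> u)"
        using index_sum_outer_mult_vec[OF u i, of 1 "\<lambda>_. w"] by simp
      also have "\<dots> = (X *\<^sub>v v) $ i * (u \<bullet> (X *\<^sub>v v)) / (sqrt q * sqrt q)"
        unfolding wu[OF u] using i Xc by (simp add: w_def del: index_mult_mat_vec real_sqrt_mult_self)
      finally have "(sum_outer n 1 (\<lambda>_. w) *\<^sub>v u) $ i = (X *\<^sub>v v) $ i * (u \<bullet> (X *\<^sub>v v)) / q"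
        using q0 by simp
      then show "(X *\<^sub>v u - sum_outer n 1 (\<lambda>_. w) *\<^sub>v u) $ i
          = (X *\<^sub>v u + (- ((u \<bullet> (X *\<^sub>v v)) / q)) \<cdot>\<^sub>v (X *\<^sub>v v)) $ i"
        using i Xc by (simp del: index_mult_mat_vec)
    qed (use Xc in simp)
    also have "\<dots> = X *\<^sub>v ?p u"
      using Xc u v by (simp add: mult_add_distrib_mat_vec[OF Xc u] mult_mat_vec[OF Xc v])
    finally show ?thesis .
  qed
  have Y0: "Y *\<^sub>v v = 0\<^sub>v n"
  proof -
    have "?p v = 0\<^sub>v n" using v q0 by (auto simp: q_def[symmetric])
    then show ?thesis using Yu[OF v] Xc by auto
  qed
  have "Y \<in> psd_mats n"
  proof -
    have "0 \<le> u \<bullet> (Y *\<^sub>v u)" if u: "u \<in> carrier_vec n" for u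
    proof -
      define t where "t = - ((u \<bullet> (X *\<^sub>v v)) / q)"
      have p: "?p u = u + t \<cdot>\<^sub>v v" by (simp add: t_def)
      have "u \<bullet> (Y *\<^sub>v u) = u \<bullet> (X *\<^sub>v u) + t * (u \<bullet> (X *\<^sub>v v))"
        unfolding Yu[OF u] p using Xc u v
        by (simp add: mult_add_distrib_mat_vec[OF Xc u] mult_mat_vec[OF Xc v] scalar_prod_add_distrib[of _ n])
      also have "\<dots> = (u + t \<cdot>\<^sub>v v) \<bullet> (X *\<^sub>v (u + t \<cdot>\<^sub>v v))"
        unfolding quadratic_form_add_smult[OF Xs u v] q_def[symmetric]
        using q0 by (simp add: t_def power2_eq_square field_simps)
      also have "\<dots> \<ge> 0" using X u v by (auto simp: psd_mats_def)
      finally show ?thesis .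
    qed
    then show ?thesis using Ys by (auto simp: psd_mats_def)
  qed
  moreover have "rank Y < rank X"
  proof (rule rank_less_col_space[OF Yc Xc], rule psubsetI)
    show "col_space Y \<subseteq> col_space X"
      unfolding col_space_eq[OF Yc] col_space_eq[OF Xc] using Xc Yc v Yu by auto
    \<comment> \<open>\<open>Y\<close> is symmetric and \<open>Y v = 0\<close>, so \<open>v\<close> is orthogonal to all of \<open>col_space Y\<close>.\<close>
    have "X *\<^sub>v v \<notin> col_space Y"
    proof
      assume "X *\<^sub>v v \<in> col_space Y"
      then obtain u where u: "u \<in> carrier_vec n" "Y *\<^sub>v u = X *\<^sub>v v"
        unfolding col_space_eq[OF Yc] using Yc by auto
      have "v \<bullet> (Y *\<^sub>v u) = 0" using sym_scalar_prod_commute[OF Ys v u(1)] u(1) Y0 by simp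
      then show False using q u(2) by simp
    qed
    moreover have "X *\<^sub>v v \<in> col_space X" unfolding col_space_eq[OF Xc] using Xc v by auto
    ultimately show "col_space Y \<noteq> col_space X" by auto
  qed
  ultimately show ?thesis using that w XY by blast
qed

text \<open>
  The rank is only bounded by the number \<open>r\<close> of outer products: deflation may exhaust \<open>X\<close> early,
  and the induction then stops with zero vectors.
\<close>

lemma psd_eq_sum_outer:
  assumes "X \<in> psd_mats n" and "vec_space.rank n X \<le> r"
  shows "\<exists>x. (\<forall>k<r. x k \<in> carrier_vec n) \<and> X = sum_outer n r x"
  using assms
proof (induction r arbitrary: X)
  case (0 X)
  have "v \<bullet> (X *\<^sub>v v) = 0" if v: "v \<in> carrier_vec n" for v
  proof (rule ccontr)
    assume "v \<bullet> (X *\<^sub>v v) \<noteq> 0"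
    then have q: "v \<bullet> (X *\<^sub>v v) > 0" using 0(1) v by (auto simp: psd_mats_def less_le)
    \<comment> \<open>A rank below \<open>0\<close> would result.\<close>
    show False by (rule psd_deflation[OF 0(1) v q]) (use 0(2) in simp)
  qed
  then have "X = sum_outer n 0 (\<lambda>_. 0\<^sub>v n)"
    using 0(1) sym_quadratic_form_zero_imp_zero[of X n]
    by (simp add: psd_mats_def sum_outer_zero)
  then show ?case by blast
next
  case (Suc r X)
  show ?case
  proof (cases "\<exists>v \<in> carrier_vec n. v \<bullet> (X *\<^sub>v v) \<noteq> 0")
    case True
    then obtain v where v: "v \<in> carrier_vec n" "v \<bullet> (X *\<^sub>v v) > 0"
      using Suc.prems(1) by (auto simp: psd_mats_def less_le)
    obtain Y w where Y: "Y \<in> psd_mats n" "w \<in> carrier_vec n" "X = Y + sum_outer n 1 (\<lambda>_. w)"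
      "vec_space.rank n Y < vec_space.rank n X"
      by (rule psd_deflation[OF Suc.prems(1) v])
    from Y(4) Suc.prems(2) have "vec_space.rank n Y \<le> r" by simp
    then obtain x where x: "\<forall>k<r. x k \<in> carrier_vec n" "Y = sum_outer n r x"
      using Suc.IH[OF Y(1)] by blast
    have "X = sum_outer n (Suc r) (x(r := w))" unfolding Y(3) x(2) by (auto intro!: eq_matI)
    moreover have "\<forall>k<Suc r. (x(r := w)) k \<in> carrier_vec n"
      using x(1) Y(2) by (simp add: less_Suc_eq)
    ultimately show ?thesis by blast
  next
    case False
    then have "X = sum_outer n (Suc r) (\<lambda>_. 0\<^sub>v n)"
      using Suc.prems(1) sym_quadratic_form_zero_imp_zero[of X n]
      by (simp add: psd_mats_def sum_outer_zero)
    then show ?thesis by (intro exI[of _ "\<lambda>_. 0\<^sub>v n"]) simp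
  qed
qed

section \<open>Quadratic forms of repeated diagonal blocks\<close>

definition vec_block :: "nat \<Rightarrow> 'a vec \<Rightarrow> nat \<Rightarrow> 'a vec" where
  "vec_block n x k = vec n (\<lambda>i. x $ (k * n + i))"

lemma vec_block_carrier [simp]: "vec_block n x k \<in> carrier_vec n"
  by (simp add: vec_block_def)

lemma block_index_less:
  fixes k n r i :: nat
  assumes "k < r" and "i < n"
  shows "k * n + i < r * n"
proof -
  have "k * n + i < Suc k * n" using assms(2) by simp
  also have "\<dots> \<le> r * n" using assms(1) by (intro mult_le_mono1) simp
  finally show ?thesis .
qed

lemma vec_block_zero: "k < r \<Longrightarrow> vec_block n (0\<^sub>v (r * n)) k = 0\<^sub>v n"
  by (rule eq_vecI) (simp_all add: vec_block_def block_index_less)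

lemma vec_block_surj:
  assumes "\<And>k. k < r \<Longrightarrow> y k \<in> carrier_vec n"
  obtains x where "x \<in> carrier_vec (r * n)" "\<forall>k<r. vec_block n x k = y k"
proof -
  define x where "x = vec (r * n) (\<lambda>l. y (l div n) $ (l mod n))"
  have "vec_block n x k = y k" if k: "k < r" for k
  proof (rule eq_vecI)
    fix i assume "i < dim_vec (y k)"
    then have i: "i < n" using assms[OF k] by simp
    then show "vec_block n x k $ i = y k $ i"
      using k by (simp add: vec_block_def x_def block_index_less)
  qed (use assms[OF k] in \<open>simp add: vec_block_def\<close>)
  then show ?thesis using that[of x] by (simp add: x_def)
qed

lemma quadratic_form_diag_block_replicate:
  fixes A :: "'a :: comm_semiring_1 mat"
  assumes A: "A \<in> carrier_mat n n" and x: "x \<in> carrier_vec (r * n)"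
  shows "x \<bullet> (diag_block_mat (replicate r A) *\<^sub>v x)
    = (\<Sum>k<r. vec_block n x k \<bullet> (A *\<^sub>v vec_block n x k))"
  using x
proof (induction r arbitrary: x)
  case 0
  then show ?case by (simp add: scalar_prod_def)
next
  case (Suc r)
  let ?D = "diag_block_mat (replicate r A)"
  define u where "u = vec_block n x 0"
  define y where "y = vec (r * n) (\<lambda>i. x $ (n + i))"
  have D: "?D \<in> carrier_mat (r * n) (r * n)"
    by (rule carrier_matI) (use A in \<open>simp_all add: dim_diag_block_mat sum_list_replicate\<close>)
  have u: "u \<in> carrier_vec n" and y: "y \<in> carrier_vec (r * n)" by (auto simp: u_def y_def)
  have xuy: "x = u @\<^sub>v y" by (rule eq_vecI) (use Suc.prems in \<open>auto simp: u_def y_def vec_block_def\<close>)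
  have blk: "vec_block n y k = vec_block n x (Suc k)" if k: "k < r" for k
  proof (rule eq_vecI)
    fix i assume "i < dim_vec (vec_block n x (Suc k))"
    then have i: "i < n" by (simp add: vec_block_def)
    then show "vec_block n y k $ i = vec_block n x (Suc k) $ i"
      using k by (simp add: vec_block_def y_def block_index_less add.assoc)
  qed (simp add: vec_block_def)
  have "diag_block_mat (replicate (Suc r) A) = four_block_mat A (0\<^sub>m n (r * n)) (0\<^sub>m (r * n) n) ?D"
    using A D by (simp add: Let_def)
  then have "diag_block_mat (replicate (Suc r) A) *\<^sub>v x = (A *\<^sub>v u) @\<^sub>v (?D *\<^sub>v y)"
    unfolding xuy using mult_mat_vec_split[OF A D u y] by simp
  then have "x \<bullet> (diag_block_mat (replicate (Suc r) A) *\<^sub>v x) = u \<bullet> (A *\<^sub>v u) + y \<bullet> (?D *\<^sub>v y)"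
    using scalar_prod_append[of u n y "r * n" "A *\<^sub>v u" "?D *\<^sub>v y"] A D u y by (simp add: xuy)
  also have "y \<bullet> (?D *\<^sub>v y) = (\<Sum>k<r. vec_block n x (Suc k) \<bullet> (A *\<^sub>v vec_block n x (Suc k)))"
    unfolding Suc.IH[OF y] by (simp add: blk)
  finally show ?case unfolding u_def sum.lessThan_Suc_shift .
qed

lemma trace_mult_sum_outer_vec_block:
  assumes "A \<in> carrier_mat n n" and "x \<in> carrier_vec (r * n)"
  shows "mat_trace (A * sum_outer n r (vec_block n x))
    = x \<bullet> (diag_block_mat (replicate r A) *\<^sub>v x)"
  using assms by (simp add: trace_mult_sum_outer quadratic_form_diag_block_replicate)

theorem proposition6:
  fixes n m r :: nat
    and A :: "nat \<Rightarrow> real mat"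
    and b :: "real vec"
  assumes "n \<ge> 1" and "m \<ge> 1" and "r \<ge> 1"
    and "\<And>i. i < m \<Longrightarrow> A i \<in> sym_mats n"
    and "b \<in> carrier_vec m"
  shows "((\<exists>X \<in> psd_mats n. (\<forall>i<m. mat_trace (A i * X) = b $ i) \<and> mat_rank X = r)
           \<longrightarrow> (\<exists>x \<in> carrier_vec (r * n). x \<noteq> 0\<^sub>v (r * n) \<and>
                 (\<forall>i<m. x \<bullet> (diag_block_mat (replicate r (A i)) *\<^sub>v x) = b $ i)))
       \<and> ((\<exists>x \<in> carrier_vec (r * n). x \<noteq> 0\<^sub>v (r * n) \<and>
                 (\<forall>i<m. x \<bullet> (diag_block_mat (replicate r (A i)) *\<^sub>v x) = b $ i))
           \<longrightarrow> (\<exists>X \<in> psd_mats n. (\<forall>i<m. mat_trace (A i * X) = b $ i) \<and> mat_rank X \<le> r))"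
proof (intro conjI impI)
  have A: "A i \<in> carrier_mat n n" if "i < m" for i using assms(4)[OF that] by (auto simp: sym_mats_def)
  {
    assume "\<exists>X \<in> psd_mats n. (\<forall>i<m. mat_trace (A i * X) = b $ i) \<and> mat_rank X = r"
    then obtain X where X: "X \<in> psd_mats n" "\<And>i. i < m \<Longrightarrow> mat_trace (A i * X) = b $ i"
      and "mat_rank X = r" by blast
    then have rank: "vec_space.rank n X = r" by (auto simp: psd_mats_def sym_mats_def)
    obtain y where y: "\<And>k. k < r \<Longrightarrow> y k \<in> carrier_vec n" "X = sum_outer n r y"
      using psd_eq_sum_outer[OF X(1), of r] rank by auto
    obtain x where x: "x \<in> carrier_vec (r * n)" "\<forall>k<r. vec_block n x k = y k"
      by (rule vec_block_surj[of r y n, OF y(1)])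
    have Xx: "X = sum_outer n r (vec_block n x)" unfolding y(2) by (simp add: sum_outer_def x(2))
    have "x \<noteq> 0\<^sub>v (r * n)"
    proof
      assume x0: "x = 0\<^sub>v (r * n)"
      have "X = 0\<^sub>m n n"
        unfolding Xx sum_outer_zero[of n r, symmetric] by (simp add: sum_outer_def x0 vec_block_zero)
      then show False using rank vec_space.rank_0I[of n n, where 'a = real] assms(3) by simp
    qed
    then show "\<exists>x \<in> carrier_vec (r * n). x \<noteq> 0\<^sub>v (r * n) \<and>
        (\<forall>i<m. x \<bullet> (diag_block_mat (replicate r (A i)) *\<^sub>v x) = b $ i)"
      using x(1) X(2) A trace_mult_sum_outer_vec_block[OF _ x(1)] unfolding Xx by auto
  next
    assume "\<exists>x \<in> carrier_vec (r * n). x \<noteq> 0\<^sub>v (r * n) \<and>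
        (\<forall>i<m. x \<bullet> (diag_block_mat (replicate r (A i)) *\<^sub>v x) = b $ i)"
    then obtain x where x: "x \<in> carrier_vec (r * n)"
      "\<And>i. i < m \<Longrightarrow> x \<bullet> (diag_block_mat (replicate r (A i)) *\<^sub>v x) = b $ i" by blast
    then show "\<exists>X \<in> psd_mats n. (\<forall>i<m. mat_trace (A i * X) = b $ i) \<and> mat_rank X \<le> r"
      using sum_outer_psd[of r "vec_block n x" n] rank_sum_outer_le[of r "vec_block n x" n] A
      by (intro bexI[of _ "sum_outer n r (vec_block n x)"])
        (auto simp: trace_mult_sum_outer_vec_block)
  }
qed

end
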